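(* Let $A$ be an $n\times n$ matrix which is either a pseudo principal matrix of some $\mathbf{a}=(a_1,\dots,a_n)$ with positive integer entries, or a principal matrix of some set $\mathbf{a}=\{a_1,\dots,a_n\}$ of positive integers minimally generating the semigroup $\langle\mathbf{a}\rangle$. Then $\operatorname{rank} A\ge \frac{n}{2}$.
   Context: An $n\times n$ integer matrix $A=(a_{ij})$ is called pseudo principal if $a_{ii}<0$ for all $i$, $a_{ij}\ge 0$ for all $i\ne j$, and there exist positive integers $a_1,\dots,a_n$ such that $A(a_1,\dots,a_n)^T=0$; one then says $A$ is a pseudo principal matrix of $\mathbf{a}=(a_1,\dots,a_n)$ and writes $A=P(\mathbf{a})$. For a set $\mathbf{a}=\{a_1,\dots,a_n\}$ of positive integers, $\langle \mathbf{a}\rangle$ denotes the additive monoid of all non-negative integer combinations of the $a_i$. If $\mathbf{a}$ minimally generates $\langle\mathbf{a}\rangle$, a principal matrix of $\mathbf{a}$, written $D(\mathbf{a})$, is an $n\times n$ integer matrix with diagonal entries $-c_1,\dots,-c_n$ and non-negative off-diagonal entries $a_{ij}$ such that $A(a_1,\dots,a_n)^T=0$ and, for each $i$, $c_i$ is the smallest positive integer with $c_ia_i\in\langle \mathbf{a}\setminus\{a_i\}\rangle$. (The off-diagonal entries are not always uniquely determined by $\mathbf{a}$.) *)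

theory Defs
  imports "HOL-Analysis.Analysis"
begin

definition pseudo_principal_matrix :: "int^'n^'n \<Rightarrow> int^'n \<Rightarrow> bool" where
  "pseudo_principal_matrix A a \<longleftrightarrow>
     (\<forall>i. A $ i $ i < 0) \<and>
     (\<forall>i j. i \<noteq> j \<longrightarrow> 0 \<le> A $ i $ j) \<and>
     (\<forall>i. 0 < a $ i) \<and>
     A *v a = 0"

definition monoid_gen :: "int set \<Rightarrow> int set" where
  "monoid_gen S = {\<Sum>s\<in>F. int (k s) * s | F k. finite F \<and> F \<subseteq> S}"

definition minimally_generating :: "int set \<Rightarrow> bool" where
  "minimally_generating S \<longleftrightarrow> (\<forall>T. T \<subset> S \<longrightarrow> monoid_gen T \<noteq> monoid_gen S)"

(* The set {a_1, ..., a_n} is given by an enumeration without repetitions, so that it has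
   exactly n elements; the diagonal entry in row i is -c_i. *)
definition principal_matrix :: "int^'n^'n \<Rightarrow> int^'n \<Rightarrow> bool" where
  "principal_matrix A a \<longleftrightarrow>
     (\<forall>i. 0 < a $ i) \<and>
     inj (\<lambda>i. a $ i) \<and>
     minimally_generating (range (\<lambda>i. a $ i)) \<and>
     (\<forall>i j. i \<noteq> j \<longrightarrow> 0 \<le> A $ i $ j) \<and>
     A *v a = 0 \<and>
     (\<forall>i. let c = - (A $ i $ i); G = monoid_gen (range (\<lambda>j. a $ j) - {a $ i}) in
            0 < c \<and> c * a $ i \<in> G \<and> (\<forall>m. 0 < m \<and> m * a $ i \<in> G \<longrightarrow> c \<le> m))"

end

theory Submission
  imports Defs
begin

text \<open>
  Let \<open>E\<close> be the digraph with an edge from \<open>i\<close> to \<open>j \<noteq> i\<close> whenever \<open>A\<^sub>i\<^sub>j > 0\<close>. If \<open>A x = 0\<close>, then a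
  maximum principle shows that the set where \<open>x\<^sub>i / a\<^sub>i\<close> is maximal is closed under edges. Hence a
  kernel vector vanishing on a set \<open>T\<close> that is reachable from every vertex is zero, so the columns
  outside \<open>T\<close> are independent. Every vertex has an outgoing edge; in a smallest \<open>T\<close> no element
  reaches another one, so choosing an out-neighbour of each element injects \<open>T\<close> into its complement,
  and \<open>T\<close> has at most \<open>n/2\<close> elements.
\<close>

lemma small_absorbing_set:
  fixes E :: "('a::finite) rel"
  assumes out: "\<And>i. \<exists>j. j \<noteq> i \<and> (i, j) \<in> E"
  obtains T where "\<And>i. \<exists>t\<in>T. (i, t) \<in> E\<^sup>*" and "2 * card T \<le> CARD('a)"
proof -
  let ?P = "\<lambda>T. \<forall>i. \<exists>t\<in>T. (i, t) \<in> E\<^sup>*"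
  have "?P UNIV" by blast
  then obtain T where T: "?P T" and least: "\<And>U. ?P U \<Longrightarrow> card T \<le> card U"
    using ex_has_least_nat[of ?P UNIV card] by blast
  \<comment> \<open>If \<open>s\<close> reaches another element \<open>t\<close> of
    \<open>T\<close>, every path into \<open>s\<close> continues to \<open>t\<close>, so
    \<open>T - {s}\<close> would be a smaller absorbing set.\<close>
  have anti: "s = t" if st: "s \<in> T" "t \<in> T" "(s, t) \<in> E\<^sup>*" for s t
  proof (rule ccontr)
    assume "s \<noteq> t"
    have "?P (T - {s})"
    proof
      fix i
      obtain u where u: "u \<in> T" "(i, u) \<in> E\<^sup>*" using T by blast
      show "\<exists>t\<in>T - {s}. (i, t) \<in> E\<^sup>*"
        using u st \<open>s \<noteq> t\<close> by (cases "u = s") (auto intro: rtrancl_trans)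
    qed
    from least[OF this] show False
      using st(1) by (metis card_Diff1_less finite not_less)
  qed
  obtain f where f: "\<And>i. f i \<noteq> i" "\<And>i. (i, f i) \<in> E"
    using out by metis
  have return: "(f t, t) \<in> E\<^sup>*" if "t \<in> T" for t
  proof -
    obtain u where u: "u \<in> T" "(f t, u) \<in> E\<^sup>*" using T by blast
    then have "(t, u) \<in> E\<^sup>*" using f(2) by (meson converse_rtrancl_into_rtrancl)
    then show ?thesis using anti that u by blast
  qed
  \<comment> \<open>If \<open>f s = f t\<close>, then \<open>s\<close> steps to \<open>f t\<close>,
    which returns to \<open>t\<close>; so \<open>s\<close> reaches \<open>t\<close> and
    \<open>anti\<close> applies.\<close>
  have "inj_on f T"
    by (rule inj_onI) (metis anti return converse_rtrancl_into_rtrancl f(2))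
  \<comment> \<open>Were \<open>f t\<close> in \<open>T\<close>, the edge from \<open>t\<close>
    would force \<open>f t = t\<close> by \<open>anti\<close>.\<close>
  moreover have "f ` T \<subseteq> - T"
    using anti f by (metis ComplI image_subsetI r_into_rtrancl)
  ultimately have "card T \<le> card (- T)"
    by (meson card_inj_on_le finite)
  also have "card (- T) = CARD('a) - card T"
    by (simp add: Compl_eq_Diff_UNIV card_Diff_subset)
  finally have "2 * card T \<le> CARD('a)"
    using card_mono[of UNIV T] by simp
  with T show ?thesis using that by blast
qed

text \<open>\<open>M\<close> is injective on the coordinate subspace of vectors vanishing on
  \<open>T\<close>, so its range contains an isomorphic copy of that subspace.\<close>

lemma card_le_rank:
  fixes M :: "real^'n^'m"
  assumes "\<And>x. \<lbrakk>M *v x = 0; \<And>t. t \<in> T \<Longrightarrow> x $ t = 0\<rbrakk> \<Longrightarrow> x = 0"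
  shows "card (- T) \<le> rank M"
proof -
  let ?V = "{x :: real^'n. \<forall>t\<in>T. x $ t = 0}"
  let ?B = "(\<lambda>s. axis s (1::real) :: real^'n) ` (- T)"
  have V: "subspace ?V" by (auto simp: subspace_def)
  have "?B \<subseteq> ?V"
    by (auto simp: axis_def)
  moreover have "independent ?B"
    by (rule independent_mono[OF independent_Basis]) (auto simp: Basis_vec_def)
  moreover have "card ?B = card (- T)"
    by (rule card_image) (auto simp: inj_on_def axis_eq_axis)
  ultimately have "card (- T) \<le> dim ?V"
    using independent_card_le_dim[of ?B ?V] by simp
  also have "\<dots> = dim ((*v) M ` ?V)"
  proof (rule dim_image_eq[symmetric])
    have "inj_on ((*v) M) ?V"
    proof (rule inj_onI)
      fix x y assume "x \<in> ?V" "y \<in> ?V" "M *v x = M *v y"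
      then have "x - y = 0"
        by (intro assms) (auto simp: matrix_vector_mult_diff_distrib)
      then show "x = y" by simp
    qed
    then show "inj_on ((*v) M) (span ?V)"
      by (simp add: span_eq_iff[THEN iffD2, OF V])
  qed simp
  also have "\<dots> \<le> rank M"
    unfolding rank_dim_range by (rule dim_subset) auto
  finally show ?thesis .
qed

text \<open>A one-sided bound suffices: the conditions on \<open>x\<close> are invariant under
  negation, so using it for \<open>x\<close> and \<open>- x\<close> yields
  \<open>x = 0\<close>.\<close>

lemma kernel_maximum_principle:
  fixes M :: "real^'n^'n"
  assumes nonneg: "\<And>i j. i \<noteq> j \<Longrightarrow> 0 \<le> M $ i $ j"
    and pos: "\<And>i. 0 < a $ i" and Ma: "M *v a = 0" and Mx: "M *v x = 0"
    and absorb: "\<And>i. \<exists>t\<in>T. (i, t) \<in> {(i, j). i \<noteq> j \<and> 0 < M $ i $ j}\<^sup>*"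
    and zero: "\<And>t. t \<in> T \<Longrightarrow> x $ t = 0"
  shows "x $ i \<le> 0"
proof -
  let ?E = "{(i, j). i \<noteq> j \<and> 0 < M $ i $ j}"
  define y where "y j = x $ j / a $ j" for j
  have xy: "x $ j = a $ j * y j" for j
    using pos[of j] by (simp add: y_def)
  define m where "m = Max (range y)"
  have le: "y j \<le> m" for j by (simp add: m_def)
  have "m \<in> range y" unfolding m_def by (rule Max_in) auto
  then obtain k where k: "y k = m" by auto
  have step: "y j = m" if "y i = m" "(i, j) \<in> ?E" for i j
  proof -
    have "(\<Sum>l\<in>UNIV. M $ i $ l * a $ l * (m - y l))
        = m * (M *v a) $ i - (M *v x) $ i"
      by (simp add: matrix_vector_mult_def xy sum_distrib_left flip: sum_subtractf)
        (simp add: algebra_simps)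
    also have "\<dots> = 0" using Ma Mx by simp
    finally have "(\<Sum>l\<in>UNIV. M $ i $ l * a $ l * (m - y l)) = 0" .
    \<comment> \<open>The diagonal term vanishes since \<open>y i = m\<close>; in all others each
      factor is nonnegative.\<close>
    moreover have "0 \<le> M $ i $ l * a $ l * (m - y l)" for l
      using that(1) nonneg[of i l] less_imp_le[OF pos[of l]] le[of l] by (cases "l = i") simp_all
    ultimately have "M $ i $ j * a $ j * (m - y j) = 0"
      by (simp add: sum_nonneg_eq_0_iff)
    then show ?thesis using that(2) pos[of j] by auto
  qed
  \<comment> \<open>Equality with \<open>m\<close> spreads from the maximizer \<open>k\<close> along
    a path into \<open>T\<close>, where \<open>y\<close> is zero.\<close>
  obtain t where t: "t \<in> T" "(k, t) \<in> ?E\<^sup>*" using absorb by blast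
  from t(2) have "y t = m"
    by (induction rule: rtrancl_induct) (use k step in blast)+
  then have "m = 0" using zero[OF t(1)] by (simp add: y_def)
  then show ?thesis
    using le[of i] pos[of i] by (simp add: xy mult_le_0_iff)
qed

lemma rank_ge_half:
  fixes M :: "real^'n^'n"
  assumes diag: "\<And>i. M $ i $ i < 0"
    and nonneg: "\<And>i j. i \<noteq> j \<Longrightarrow> 0 \<le> M $ i $ j"
    and pos: "\<And>i. 0 < a $ i" and Ma: "M *v a = 0"
  shows "CARD('n) \<le> 2 * rank M"
proof -
  let ?E = "{(i, j). i \<noteq> j \<and> 0 < M $ i $ j}"
  have "\<exists>j. j \<noteq> i \<and> (i, j) \<in> ?E" for i
  proof (rule ccontr)
    assume "\<not> ?thesis"
    \<comment> \<open>Without an outgoing edge, row \<open>i\<close> has no positive entry, and its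
      negative diagonal makes \<open>(M *v a) $ i\<close> negative.\<close>
    then have "M $ i $ j * a $ j \<le> 0" for j
      using diag[of i] pos[of j] by (cases "j = i") (auto simp: mult_le_0_iff not_less)
    moreover have "M $ i $ i * a $ i < 0"
      using diag[of i] pos[of i] by (rule mult_neg_pos)
    ultimately have "(\<Sum>j\<in>UNIV. M $ i $ j * a $ j) < (\<Sum>j\<in>(UNIV::'n set). 0)"
      by (intro sum_strict_mono_ex1) auto
    moreover have "(M *v a) $ i = 0" using Ma by simp
    ultimately show False by (simp add: matrix_vector_mult_def)
  qed
  then obtain T where T: "\<And>i. \<exists>t\<in>T. (i, t) \<in> ?E\<^sup>*" and card: "2 * card T \<le> CARD('n)"
    using small_absorbing_set[of ?E] by blast
  have "card (- T) \<le> rank M"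
  proof (rule card_le_rank)
    fix x assume x: "M *v x = 0" "\<And>t. t \<in> T \<Longrightarrow> x $ t = 0"
    have neg: "M *v (- x) = 0"
      using x(1) matrix_vector_mult_diff_distrib[of M 0 x] by simp
    have "(- x) $ i \<le> 0" for i
      by (rule kernel_maximum_principle[OF nonneg pos Ma neg T]) (use x(2) in auto)
    moreover have "x $ i \<le> 0" for i
      by (rule kernel_maximum_principle[OF nonneg pos Ma x(1) T]) (use x(2) in auto)
    ultimately show "x = 0" by (simp add: vec_eq_iff antisym)
  qed
  then show ?thesis using card by (simp add: Compl_eq_Diff_UNIV card_Diff_subset)
qed

theorem corollary12:
  fixes A :: "int^'n^'n"
  assumes "(\<exists>a. pseudo_principal_matrix A a) \<or> (\<exists>a. principal_matrix A a)"
  shows "real (rank (map_matrix real_of_int A)) \<ge> real CARD('n) / 2"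
proof -
  \<comment> \<open>A principal matrix is also pseudo principal: its diagonal entries are
    \<open>-c\<close> with \<open>c\<close> positive.\<close>
  obtain a where a: "pseudo_principal_matrix A a"
    using assms unfolding pseudo_principal_matrix_def principal_matrix_def Let_def
    by (metis neg_0_less_iff_less)
  let ?M = "map_matrix real_of_int A" and ?a = "(\<chi> i. real_of_int (a $ i)) :: real^'n"
  have "?M *v ?a = (\<chi> i. real_of_int ((A *v a) $ i))"
    by (simp add: vec_eq_iff matrix_vector_mult_def)
  then have "?M *v ?a = 0"
    using a by (simp add: pseudo_principal_matrix_def vec_eq_iff)
  then have "CARD('n) \<le> 2 * rank ?M"
    using a by (intro rank_ge_half[of ?M ?a])
      (auto simp: pseudo_principal_matrix_def)
  then show ?thesis by linarith
qed

end
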